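(* If $G$ is a $\kappa$-vertex-connected graph ($\kappa \geq 1$) of order $n$, then for every integer $l \geq 0$, $$rc(G) \leq \left(\frac{2l+1}{\kappa l + 1}\right) n + 2l(2l+2) - 1.$$
   Context: All graphs are finite, simple and undirected. A path is a rainbow path if no two of its edges have the same colour. An edge colouring of a connected graph is a rainbow colouring if every pair of vertices is joined by at least one rainbow path. The rainbow connection number $rc(G)$ of a connected graph $G$ is the minimum number of colours in a rainbow colouring of $G$. A graph is $\kappa$-vertex-connected if its vertex connectivity (the minimum number of vertices whose removal disconnects the graph) is at least $\kappa$. *)

theory Defs
  imports "Graph_Theory.Graph_Theory"
begin

(* A finite simple undirected graph is a pair_graph: a finite loop-free symmetric set of pairs.
   An undirected edge is the two-element set carried by the two opposite arcs, so that an edge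
   colouring gives both arcs the same colour by construction. *)

definition edges :: "'a pair_pre_digraph \<Rightarrow> 'a set set" where
  "edges G = (\<lambda>(u, v). {u, v}) ` parcs G"

definition rainbow_path ::
    "'a pair_pre_digraph \<Rightarrow> ('a set \<Rightarrow> 'c) \<Rightarrow> 'a \<Rightarrow> 'a list \<Rightarrow> 'a \<Rightarrow> bool" where
  "rainbow_path G c u p v \<longleftrightarrow>
     vpath p (with_proj G) \<and> hd p = u \<and> last p = v \<and>
     distinct (map (\<lambda>(x, y). c {x, y}) (vwalk_arcs p))"

definition rainbow_colouring :: "'a pair_pre_digraph \<Rightarrow> ('a set \<Rightarrow> 'c) \<Rightarrow> bool" where
  "rainbow_colouring G c \<longleftrightarrow>
     (\<forall>u \<in> pverts G. \<forall>v \<in> pverts G. \<exists>p. rainbow_path G c u p v)"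

(* Only meaningful for connected G, where giving distinct colours to distinct edges shows that
   some k qualifies. *)

definition rainbow_connection_number :: "'a pair_pre_digraph \<Rightarrow> nat" where
  "rainbow_connection_number G =
     (LEAST k. \<exists>c :: 'a set \<Rightarrow> nat. rainbow_colouring G c \<and> card (c ` edges G) = k)"

(* The condition S \<noteq> pverts G is needed because the null graph is not connected in the sense of
   the library, while deleting all vertices does not count as disconnecting G. *)

definition disconnects :: "'a pair_pre_digraph \<Rightarrow> 'a set \<Rightarrow> bool" where
  "disconnects G S \<longleftrightarrow>
     S \<subseteq> pverts G \<and> S \<noteq> pverts G \<and>
     \<not> Digraph_Component.connected (with_proj G \<restriction> (pverts G - S))"

(* The complete graphs are exactly those without a disconnecting set; as usual, the connectivity
   of the complete graph on m vertices is m - 1. *)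

definition vertex_connectivity :: "'a pair_pre_digraph \<Rightarrow> nat" where
  "vertex_connectivity G =
     (if \<exists>S. disconnects G S
      then (LEAST k. \<exists>S. disconnects G S \<and> card S = k)
      else card (pverts G) - 1)"

end

theory Submission
  imports Defs
begin

text \<open>Grow a tree greedily from centres, each new centre lying at distance exactly
  \<open>2l + 1\<close> from the tree built so far. It ends up \<open>2l\<close>-dominating, the balls of radius \<open>l\<close> around
  the centres are disjoint, and if there are two or more of them, each has at least \<open>\<kappa>l + 1\<close>
  vertices since each of its spheres is a vertex cut. A tree is rainbow coloured by giving its
  edges distinct colours.

  It remains to turn a rainbow coloured \<open>k\<close>-dominating set \<open>D\<close> into a \<open>(k - 1)\<close>-dominating one with
  \<open>2k + 1\<close> new colours, which summed over \<open>k \<le> 2l\<close> costs \<open>2l(2l + 2)\<close>. Take a breadth-first forest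
  of the vertices outside \<open>D\<close>, rooted at the neighbours of \<open>D\<close>. When \<open>\<kappa> \<ge> 2\<close>, every tree is left by
  an edge other than the one joining its root to \<open>D\<close>, so the trees can be labelled low and high
  such that each tree has an edge to a tree of the other label or a second edge to \<open>D\<close>.
  Add to \<open>D\<close> the ancestors of the ends of those exit edges. Forest edges are coloured by depth,
  from two disjoint palettes for low and high, and the exit edges share one more colour. A new
  vertex reaches \<open>D\<close> either down its branch or up to an exit edge and down from there; of two
  new vertices with the same label, the shallower goes down and the deeper goes up.\<close>

subsection \<open>Rainbow walks\<close>

text \<open>The index \<open>C\<close> is the exact set of colours used, so walks can be joined
  whenever their colour sets are disjoint. Vertices may repeat; repetitions are removed only when a
  path is needed.\<close>

inductive rainbow_walk ::
    "'a rel \<Rightarrow> 'a set \<Rightarrow> ('a \<Rightarrow> 'a \<Rightarrow> nat) \<Rightarrow> nat set \<Rightarrow> 'a \<Rightarrow> 'a \<Rightarrow> bool"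
  for E D c where
  refl: "u \<in> D \<Longrightarrow> rainbow_walk E D c {} u u"
| step: "u \<in> D \<Longrightarrow> (u, w) \<in> E \<Longrightarrow> rainbow_walk E D c C w v \<Longrightarrow> c u w \<notin> C
    \<Longrightarrow> rainbow_walk E D c (insert (c u w) C) u v"

lemma rainbow_walk_endpoints:
  "rainbow_walk E D c C u v \<Longrightarrow> u \<in> D \<and> v \<in> D"
  by (induction rule: rainbow_walk.induct) auto

lemma rainbow_walk_edge:
  assumes "u \<in> D" "v \<in> D" "(u, v) \<in> E"
  shows "rainbow_walk E D c {c u v} u v"
  using rainbow_walk.step[OF assms(1,3) rainbow_walk.refl] assms(2) by auto

lemma rainbow_walk_trans:
  assumes "rainbow_walk E D c C u w" "rainbow_walk E D c C' w v" "C \<inter> C' = {}"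
  shows "rainbow_walk E D c (C \<union> C') u v"
  using assms
proof (induction rule: rainbow_walk.induct)
  case (step u w C v')
  then have "rainbow_walk E D c (insert (c u w) (C \<union> C')) u v"
    by (intro rainbow_walk.step) auto
  then show ?case by simp
qed simp

lemma rainbow_walk_sym:
  assumes "sym E" "\<And>x y. c x y = c y x" "rainbow_walk E D c C u v"
  shows "rainbow_walk E D c C v u"
  using assms(3)
proof (induction rule: rainbow_walk.induct)
  case (refl u)
  then show ?case by (rule rainbow_walk.refl)
next
  case (step u w C v)
  then have "rainbow_walk E D c {c w u} w u"
    using rainbow_walk_endpoints[of E D c C w v] assms(1)
    by (intro rainbow_walk_edge) (auto dest: symD)
  then have "rainbow_walk E D c (C \<union> {c w u}) v u"
    using step.IH step.hyps(4) assms(2)[of u w] by (intro rainbow_walk_trans) auto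
  then show ?case using assms(2)[of u w] by simp
qed

lemma rainbow_walk_mono:
  assumes "rainbow_walk E D c C u v" "D \<subseteq> D'" "\<And>x y. x \<in> D \<Longrightarrow> y \<in> D \<Longrightarrow> c' x y = c x y"
  shows "rainbow_walk E D' c' C u v"
  using assms(1)
proof (induction rule: rainbow_walk.induct)
  case (refl u)
  then show ?case using assms(2) by (auto intro: rainbow_walk.refl)
next
  case (step u w C v)
  then have "c' u w = c u w"
    using rainbow_walk_endpoints[of E D c C w v] assms(3) by auto
  with step assms(2) rainbow_walk.step[of u D' w E c' C v] show ?case by auto
qed

text \<open>Only the colours on the chosen walks are bounded; other edges may have any colour.\<close>

definition rainbow_set :: "'a rel \<Rightarrow> 'a set \<Rightarrow> nat \<Rightarrow> bool" where
  "rainbow_set E D m \<longleftrightarrow> (\<exists>c. (\<forall>x y. c x y = c y x) \<and>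
     (\<forall>u\<in>D. \<forall>v\<in>D. \<exists>C\<subseteq>{..<m}. rainbow_walk E D c C u v))"

lemma rainbow_set_singleton: "rainbow_set E {v} 0"
  unfolding rainbow_set_def
  by (rule exI[of _ "\<lambda>x y. 0"]) (auto intro: rainbow_walk.refl)

lemma rainbow_set_mono:
  "rainbow_set E D m \<Longrightarrow> m \<le> m' \<Longrightarrow> rainbow_set E D m'"
  unfolding rainbow_set_def by (meson lessThan_subset_iff subset_trans)

text \<open>Every pair containing the new vertex \<open>z\<close> gets the fresh colour
  \<open>m\<close>; a walk from \<open>z\<close> uses it once, on the edge to \<open>y\<close>, and
  continues with old colours.\<close>

lemma rainbow_set_insert:
  assumes "sym E" "rainbow_set E D m" "y \<in> D" "(y, z) \<in> E"
  shows "rainbow_set E (insert z D) (Suc m)"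
proof (cases "z \<in> D")
  case True
  then show ?thesis using assms(2) by (auto simp: insert_absorb intro: rainbow_set_mono)
next
  case False
  obtain c where c: "\<And>x y. c x y = c y x"
      "\<And>u v. u \<in> D \<Longrightarrow> v \<in> D \<Longrightarrow> \<exists>C\<subseteq>{..<m}. rainbow_walk E D c C u v"
    using assms(2) unfolding rainbow_set_def by metis
  define c' where "c' x w = (if x = z \<or> w = z then m else c x w)" for x w
  have c'_sym: "c' x w = c' w x" for x w
    using c(1) by (auto simp: c'_def)
  have old: "\<exists>C\<subseteq>{..<m}. rainbow_walk E (insert z D) c' C u v" if uv: "u \<in> D" "v \<in> D" for u v
  proof -
    obtain C where C: "C \<subseteq> {..<m}" "rainbow_walk E D c C u v"
      using c(2)[OF uv] by auto
    have "rainbow_walk E (insert z D) c' C u v"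
      by (rule rainbow_walk_mono[OF C(2)]) (use False in \<open>auto simp: c'_def\<close>)
    with C(1) show ?thesis by blast
  qed
  have new: "\<exists>C\<subseteq>{..<Suc m}. rainbow_walk E (insert z D) c' C z v" if v: "v \<in> D" for v
  proof -
    obtain C where C: "C \<subseteq> {..<m}" "rainbow_walk E (insert z D) c' C y v"
      using old[OF assms(3) v] by auto
    have "rainbow_walk E (insert z D) c' (insert (c' z y) C) z v"
      using C assms(1,4) by (intro rainbow_walk.step) (auto simp: c'_def dest: symD)
    moreover have "insert (c' z y) C \<subseteq> {..<Suc m}" using C by (auto simp: c'_def)
    ultimately show ?thesis by blast
  qed
  have new': "\<exists>C\<subseteq>{..<Suc m}. rainbow_walk E (insert z D) c' C v z" if v: "v \<in> D" for v
  proof -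
    obtain C where C: "C \<subseteq> {..<Suc m}" "rainbow_walk E (insert z D) c' C z v"
      using new[OF v] by auto
    have "rainbow_walk E (insert z D) c' C v z"
      by (rule rainbow_walk_sym[OF assms(1) c'_sym C(2)])
    with C(1) show ?thesis by auto
  qed
  have old': "\<exists>C\<subseteq>{..<Suc m}. rainbow_walk E (insert z D) c' C u v"
    if uv: "u \<in> D" "v \<in> D" for u v
  proof -
    obtain C where C: "C \<subseteq> {..<m}" "rainbow_walk E (insert z D) c' C u v"
      using old[OF uv] by auto
    then have "C \<subseteq> {..<Suc m}" by auto
    with C(2) show ?thesis by auto
  qed
  have triv: "\<exists>C\<subseteq>{..<Suc m}. rainbow_walk E (insert z D) c' C z z"
    by (rule exI[of _ "{}"]) (auto intro: rainbow_walk.refl)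
  show ?thesis unfolding rainbow_set_def
    by (rule exI[of _ c'], intro conjI allI ballI c'_sym) (use new new' old' triv in auto)
qed

subsection \<open>Neighbourhood balls\<close>

text \<open>The closed ball of radius \<open>i\<close> around \<open>X\<close> in graph distance;
  distances are handled through these balls, without path lengths.\<close>

primrec nball :: "'a rel \<Rightarrow> 'a set \<Rightarrow> nat \<Rightarrow> 'a set" where
  "nball E X 0 = X"
| "nball E X (Suc i) = nball E X i \<union> E `` nball E X i"

lemma nball_add: "nball E (nball E X i) j = nball E X (i + j)"
  by (induction j) auto

lemma nball_mono: "X \<subseteq> Y \<Longrightarrow> nball E X i \<subseteq> nball E Y i"
  by (induction i) auto

lemma nball_radius_mono: "i \<le> j \<Longrightarrow> nball E X i \<subseteq> nball E X j"
  by (induction j) (auto simp: le_Suc_eq)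

lemma center_in_nball: "X \<subseteq> nball E X i"
  using nball_radius_mono[of 0 i E X] by simp

lemma nball_subset: "E \<subseteq> V \<times> V \<Longrightarrow> X \<subseteq> V \<Longrightarrow> nball E X i \<subseteq> V"
  by (induction i) auto

lemma nball_singleton_sym:
  assumes "sym E" "w \<in> nball E {z} i"
  shows "z \<in> nball E {w} i"
  using assms(2)
proof (induction i arbitrary: w)
  case (Suc i)
  show ?case
  proof (cases "w \<in> nball E {z} i")
    case True
    then show ?thesis using Suc.IH by auto
  next
    case False
    then obtain y where y: "y \<in> nball E {z} i" "(y, w) \<in> E" using Suc.prems by auto
    \<comment> \<open>The last edge of the walk to \<open>w\<close> becomes the first edge of the
      reversed walk, leaving radius \<open>i\<close> to be spent from \<open>y\<close>.\<close>
    have "{y} \<subseteq> nball E {w} 1" using y(2) assms(1) by (auto dest: symD)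
    then have "nball E {y} i \<subseteq> nball E (nball E {w} 1) i" by (rule nball_mono)
    with Suc.IH[OF y(1)] show ?thesis unfolding nball_add by auto
  qed
qed simp

text \<open>A walk of at most \<open>j\<close> edges from \<open>D\<close> to \<open>z\<close> is
  added one vertex at a time, each for one new colour.\<close>

lemma rainbow_set_extend_to:
  assumes "sym E" "E \<subseteq> V \<times> V" "rainbow_set E D m" "D \<subseteq> V" "z \<in> nball E D j"
  obtains D' where "D \<subseteq> D'" "D' \<subseteq> V" "z \<in> D'" "rainbow_set E D' (m + j)"
  using assms(5)
proof (induction j arbitrary: z thesis)
  case 0
  then show ?case using assms by auto
next
  case (Suc j)
  obtain y where y: "y \<in> nball E D j" "z = y \<or> (y, z) \<in> E" using Suc.prems(2) by auto
  obtain D1 where D1: "D \<subseteq> D1" "D1 \<subseteq> V" "y \<in> D1" "rainbow_set E D1 (m + j)"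
    using Suc.IH[OF _ y(1)] by blast
  show ?case
  proof (cases "z = y")
    case True
    then show ?thesis
      using D1 Suc.prems(1)[of D1] rainbow_set_mono[OF D1(4), of "m + Suc j"] by auto
  next
    case False
    then have "(y, z) \<in> E" using y(2) by simp
    then show ?thesis
      using Suc.prems(1)[of "insert z D1"] D1 rainbow_set_insert[OF assms(1) D1(4,3)] assms(2)
      by auto
  qed
qed

subsection \<open>Enlarging a dominating set\<close>

locale layering =
  fixes E :: "'a rel" and V D :: "'a set" and k :: nat
  assumes E_sym: "sym E" and E_sub: "E \<subseteq> V \<times> V"
    and D_sub: "D \<subseteq> V" and D_dom: "V \<subseteq> nball E D k"
begin

definition depth :: "'a \<Rightarrow> nat" where
  "depth x = (LEAST i. x \<in> nball E D i)"

definition parent :: "'a \<Rightarrow> 'a" where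
  "parent x = (SOME y. (y, x) \<in> E \<and> Suc (depth y) = depth x)"

text \<open>The climb stops one step short of \<open>D\<close>: a tree is identified by its vertex
  at depth 1, not by the vertex of \<open>D\<close> behind it.\<close>

definition root :: "'a \<Rightarrow> 'a" where
  "root x = (parent ^^ (depth x - 1)) x"

lemma in_nball_depth: "x \<in> V \<Longrightarrow> x \<in> nball E D (depth x)"
  unfolding depth_def using D_dom by (metis LeastI subsetD)

lemma depth_leI: "x \<in> nball E D i \<Longrightarrow> depth x \<le> i"
  unfolding depth_def by (rule Least_le)

lemma depth_le_k: "x \<in> V \<Longrightarrow> depth x \<le> k"
  using D_dom depth_leI by blast

lemma depth_eq_0: "x \<in> V \<Longrightarrow> depth x = 0 \<longleftrightarrow> x \<in> D"
  using in_nball_depth[of x] depth_leI[of x 0] by auto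

lemma depth_pos: "x \<in> V - D \<Longrightarrow> 0 < depth x"
  using depth_eq_0[of x] by auto

lemma depth_edge:
  assumes "(x, y) \<in> E"
  shows "depth y \<le> Suc (depth x)"
proof -
  have "x \<in> V" using assms E_sub by auto
  then have "y \<in> nball E D (Suc (depth x))" using assms in_nball_depth by auto
  then show ?thesis by (rule depth_leI)
qed

lemma parent:
  assumes "x \<in> V - D"
  shows "(parent x, x) \<in> E" "Suc (depth (parent x)) = depth x" "parent x \<in> V"
proof -
  obtain i where i: "depth x = Suc i" using depth_pos[OF assms] gr0_implies_Suc by blast
  have "x \<in> nball E D (Suc i)" using in_nball_depth[of x] i assms by auto
  moreover have "x \<notin> nball E D i" using depth_leI[of x i] i by auto
  ultimately obtain y where y: "y \<in> nball E D i" "(y, x) \<in> E" by auto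
  have "Suc (depth y) = depth x" using depth_leI[OF y(1)] depth_edge[OF y(2)] i by simp
  with y(2) have "\<exists>y. (y, x) \<in> E \<and> Suc (depth y) = depth x" by blast
  from someI_ex[OF this]
  show "(parent x, x) \<in> E" "Suc (depth (parent x)) = depth x"
    unfolding parent_def by simp_all
  then show "parent x \<in> V" using E_sub by auto
qed

lemma ancestor:
  assumes "x \<in> V - D" "i \<le> depth x"
  shows "(parent ^^ i) x \<in> V" "depth ((parent ^^ i) x) = depth x - i"
  using assms(2)
proof (induction i)
  case 0
  { case 1 then show ?case using assms by simp }
  { case 2 then show ?case by simp }
next
  case (Suc i)
  have d: "depth ((parent ^^ i) x) = depth x - i" if "Suc i \<le> depth x"
    using Suc that by auto
  have "(parent ^^ i) x \<in> V - D" if "Suc i \<le> depth x"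
    using Suc that d[OF that] depth_eq_0[of "(parent ^^ i) x"] by auto
  note p = parent[OF this]
  { case 1 then show ?case using p by simp }
  { case 2 then show ?case using p(2) d by fastforce }
qed

lemma ancestor_notin_D:
  assumes "x \<in> V - D" "i < depth x"
  shows "(parent ^^ i) x \<in> V - D"
  using ancestor[of x i] assms depth_eq_0[of "(parent ^^ i) x"] by auto

lemma root_ancestor:
  assumes "x \<in> V - D" "i < depth x"
  shows "root ((parent ^^ i) x) = root x"
proof -
  have "depth x - 1 = (depth x - i - 1) + i" using assms by auto
  then have "(parent ^^ (depth x - 1)) x = (parent ^^ (depth x - i - 1)) ((parent ^^ i) x)"
    by (metis comp_apply funpow_add)
  then show ?thesis unfolding root_def using ancestor(2)[of x i] assms by simp
qed

lemma root_parent: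
  assumes "x \<in> V - D" "parent x \<notin> D"
  shows "root (parent x) = root x"
proof -
  have "1 < depth x"
    using parent[OF assms(1)] assms(2) depth_eq_0[of "parent x"] by auto
  then show ?thesis using root_ancestor[OF assms(1), of 1] by simp
qed

lemma root:
  assumes "x \<in> V - D"
  shows "root x \<in> V - D" "depth (root x) = 1"
  unfolding root_def using depth_pos[OF assms]
    ancestor_notin_D[OF assms, of "depth x - 1"] ancestor[OF assms, of "depth x - 1"] by auto

lemma root_depth_1: "depth x = 1 \<Longrightarrow> root x = x"
  unfolding root_def by simp

end

text \<open>\<open>L\<close> is the set of roots of the low trees; \<open>m\<close> and \<open>c\<close> are the number of colours and the
  colouring already used on \<open>D\<close>.\<close>

locale labelled_layering = layering +
  fixes L :: "'a set" and m :: nat and c :: "'a \<Rightarrow> 'a \<Rightarrow> nat"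
  assumes k_pos: "1 \<le> k" and c_sym: "c x y = c y x"
begin

section \<open>Palettes, exit edges and the new vertices\<close>

definition offset :: "'a \<Rightarrow> nat" where
  "offset x = (if root x \<in> L then 0 else k)"

text \<open>The new colours are two palettes of size \<open>k\<close>, low trees first, and the exit
  colour \<open>m + 2 * k\<close>. Depths outside \<open>D\<close> run from 1 to \<open>k\<close>,
  so the child's depth minus one is a position in the palette. All remaining pairs share the exit
  colour, but the walks below use it only on exit edges.\<close>

definition colour :: "'a \<Rightarrow> 'a \<Rightarrow> nat" where
  "colour x y =
     (if x \<in> D \<and> y \<in> D then c x y
      else if x \<in> V - D \<and> y = parent x then m + offset x + (depth x - 1)
      else if y \<in> V - D \<and> x = parent y then m + offset y + (depth y - 1)
      else m + 2 * k)"

text \<open>Between trees this is symmetric in \<open>y\<close> and \<open>w\<close>; towards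
  \<open>D\<close> it is directed out of the tree and excludes the forest edge at the root.\<close>

definition exit_edge :: "'a \<Rightarrow> 'a \<Rightarrow> bool" where
  "exit_edge y w \<longleftrightarrow> y \<in> V - D \<and> (y, w) \<in> E \<and>
     (if w \<in> D then w \<noteq> parent y else offset y \<noteq> offset w)"

definition new_verts :: "'a set" where
  "new_verts = {x. \<exists>y w i. exit_edge y w \<and> i < depth y \<and> x = (parent ^^ i) y}"

lemma parent_asym: "x \<in> V - D \<Longrightarrow> y \<in> V - D \<Longrightarrow> y = parent x \<Longrightarrow> x \<noteq> parent y"
  using parent(2)[of x] parent(2)[of y] by auto

text \<open>The two forest clauses could conflict only if each vertex were the parent of the other,
  which the depths forbid.\<close>

lemma colour_sym: "colour x y = colour y x"
  using parent_asym[of x y] parent_asym[of y x] c_sym[of x y] unfolding colour_def by auto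

lemma colour_parent: "x \<in> V - D \<Longrightarrow> colour x (parent x) = m + offset x + (depth x - 1)"
  unfolding colour_def by auto

text \<open>No exit edge is a forest edge: a forest edge outside \<open>D\<close> stays in one tree
  and so preserves the offset, and one into \<open>D\<close> leads to the parent. Hence the last
  clause of \<open>colour\<close> applies.\<close>

lemma colour_exit:
  assumes "exit_edge y w"
  shows "colour y w = m + 2 * k"
proof -
  have "offset w = offset y" if "w \<in> V - D" "y \<in> V - D" "w = parent y \<or> y = parent w"
    using that root_parent[of w] root_parent[of y] unfolding offset_def by auto
  then show ?thesis
    using assms E_sub unfolding colour_def exit_edge_def by (auto split: if_splits)
qed

lemma new_verts_sub: "new_verts \<subseteq> V - D"
  unfolding new_verts_def exit_edge_def using ancestor_notin_D by blast

text \<open>Further steps to the parent stay on the branch from the exit end \<open>y\<close>, until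
  depth 0 is reached in \<open>D\<close>.\<close>

lemma new_verts_ancestor:
  assumes "x \<in> new_verts" "i \<le> depth x"
  shows "(parent ^^ i) x \<in> D \<union> new_verts"
proof (cases "i < depth x")
  case True
  obtain y w j where y: "exit_edge y w" "j < depth y" "x = (parent ^^ j) y"
    using assms(1) unfolding new_verts_def by auto
  have "depth x = depth y - j"
    using y ancestor(2)[of y j] unfolding exit_edge_def by auto
  then have "i + j < depth y" using True by auto
  moreover have "(parent ^^ i) x = (parent ^^ (i + j)) y" using y(3) by (simp add: funpow_add)
  ultimately show ?thesis unfolding new_verts_def using y(1) by blast
next
  case False
  have x: "x \<in> V - D" using assms(1) new_verts_sub by auto
  then show ?thesis
    using ancestor[OF x assms(2)] False depth_eq_0[of "(parent ^^ i) x"] by auto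
qed

lemma exit_in_new_verts:
  assumes "exit_edge y w"
  shows "y \<in> new_verts" "w \<in> D \<union> new_verts"
proof -
  have self: "y \<in> new_verts" if "exit_edge y w" for y w
  proof -
    have "y \<in> V - D" using that unfolding exit_edge_def by auto
    then have "0 < depth y" by (rule depth_pos)
    moreover have "y = (parent ^^ 0) y" by simp
    ultimately show ?thesis using that unfolding new_verts_def by blast
  qed
  show "y \<in> new_verts" using self[OF assms] .
  \<comment> \<open>An exit edge between trees can be reversed, so its far end is a new vertex
    too.\<close>
  have "exit_edge w y" if "w \<notin> D"
    using assms that E_sym E_sub unfolding exit_edge_def by (auto dest: symD)
  then show "w \<in> D \<union> new_verts" using self by blast
qed

section \<open>Walks from the new vertices back to the dominating set\<close>

lemma descend:
  assumes "x \<in> new_verts" "i \<le> depth x"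
  shows "rainbow_walk E (D \<union> new_verts) colour
    {m + offset x + (depth x - i)..<m + offset x + depth x} x ((parent ^^ i) x)"
  using assms(2)
proof (induction i)
  case 0
  then show ?case using assms(1) by (auto intro: rainbow_walk.refl)
next
  case (Suc i)
  let ?y = "(parent ^^ i) x" and ?C = "{m + offset x + (depth x - i)..<m + offset x + depth x}"
  have x: "x \<in> V - D" using assms(1) new_verts_sub by auto
  have y: "?y \<in> V - D" using ancestor_notin_D[OF x] Suc.prems by auto
  have "offset ?y = offset x" "depth ?y = depth x - i"
    using root_ancestor[OF x, of i] ancestor(2)[OF x, of i] Suc.prems unfolding offset_def by auto
  \<comment> \<open>Each step towards \<open>D\<close> uses the colour just below the interval
    collected so far.\<close>
  then have col: "colour ?y (parent ?y) = m + offset x + (depth x - Suc i)"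
    using colour_parent[OF y] by simp
  have "rainbow_walk E (D \<union> new_verts) colour {colour ?y (parent ?y)} ?y (parent ?y)"
    using new_verts_ancestor[OF assms(1), of i] new_verts_ancestor[OF assms(1), of "Suc i"]
      Suc.prems parent(1)[OF y] E_sym
    by (intro rainbow_walk_edge) (auto dest: symD)
  with Suc have "rainbow_walk E (D \<union> new_verts) colour (?C \<union> {colour ?y (parent ?y)}) x (parent ?y)"
    by (intro rainbow_walk_trans) (auto simp: col)
  moreover have "?C \<union> {colour ?y (parent ?y)}
      = {m + offset x + (depth x - Suc i)..<m + offset x + depth x}"
    using Suc.prems by (auto simp: col)
  ultimately show ?case by simp
qed

text \<open>For \<open>x\<close> in \<open>D\<close> the depth is 0, so the interval is empty and
  the trivial walk fits the same formula.\<close>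

lemma descend_to_D:
  assumes "x \<in> D \<union> new_verts"
  obtains u where "u \<in> D"
    "rainbow_walk E (D \<union> new_verts) colour {m + offset x..<m + offset x + depth x} x u"
proof (cases "x \<in> D")
  case True
  then have "depth x = 0" using depth_eq_0[of x] D_sub by auto
  then show ?thesis using that[of x] True by (auto intro: rainbow_walk.refl)
next
  case False
  then have x: "x \<in> new_verts" "x \<in> V - D" using assms new_verts_sub by auto
  have "(parent ^^ depth x) x \<in> D"
    using ancestor[OF x(2), of "depth x"] depth_eq_0[of "(parent ^^ depth x) x"] by auto
  then show ?thesis using that descend[OF x(1), of "depth x"] by auto
qed

text \<open>Three legs: along the branch to its exit end, across the exit edge, and from there down
  to \<open>D\<close>. The first uses the own palette from position \<open>depth x\<close> on. As
  offsets are 0 or \<open>k\<close>, \<open>k - offset x\<close> starts the other palette, which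
  contains the colours of the third leg.\<close>

lemma ascend_to_D:
  assumes "x \<in> new_verts"
  obtains u C where "u \<in> D" "rainbow_walk E (D \<union> new_verts) colour C x u"
    "C \<subseteq> {m + offset x + depth x..<m + offset x + k} \<union> {m + 2 * k}
        \<union> {m + (k - offset x)..<m + (k - offset x) + k}"
proof -
  obtain y w i where y: "exit_edge y w" "i < depth y" "x = (parent ^^ i) y"
    using assms unfolding new_verts_def by auto
  have yV: "y \<in> V - D" using y(1) unfolding exit_edge_def by auto
  have off: "offset y = offset x"
    using root_ancestor[OF yV y(2)] y(3) unfolding offset_def by auto
  have dx: "depth x = depth y - i" using ancestor(2)[OF yV, of i] y(2,3) by auto
  have dy: "depth y \<le> k" using depth_le_k yV by auto
  let ?C1 = "{m + offset x + depth x..<m + offset x + depth y}"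
  have "rainbow_walk E (D \<union> new_verts) colour ?C1 y x"
    using descend[OF exit_in_new_verts(1)[OF y(1)], of i] y(2,3) off dx by simp
  then have up: "rainbow_walk E (D \<union> new_verts) colour ?C1 x y"
    using rainbow_walk_sym[OF E_sym] colour_sym by blast
  have cross: "rainbow_walk E (D \<union> new_verts) colour {m + 2 * k} y w"
    using rainbow_walk_edge[of y "D \<union> new_verts" w E colour] exit_in_new_verts[OF y(1)] y(1)
      colour_exit[OF y(1)] unfolding exit_edge_def by auto
  obtain u where u: "u \<in> D"
      "rainbow_walk E (D \<union> new_verts) colour {m + offset w..<m + offset w + depth w} w u"
    using descend_to_D[OF exit_in_new_verts(2)[OF y(1)]] by blast
  let ?C3 = "{m + offset w..<m + offset w + depth w}"
  have C3: "?C3 \<subseteq> {m + (k - offset x)..<m + (k - offset x) + k}"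
  proof (cases "w \<in> D")
    case True
    then have "depth w = 0" using depth_eq_0[of w] D_sub by auto
    then show ?thesis by simp
  next
    case False
    then have "offset w = k - offset x" using y(1) off unfolding exit_edge_def offset_def
      by (auto split: if_splits)
    moreover have "depth w \<le> k" using y(1) E_sub depth_le_k unfolding exit_edge_def by auto
    ultimately show ?thesis by auto
  qed
  have ox: "offset x = 0 \<or> offset x = k" unfolding offset_def by auto
  have "rainbow_walk E (D \<union> new_verts) colour (?C1 \<union> {m + 2 * k}) x w"
    by (rule rainbow_walk_trans[OF up cross]) (use ox dy in auto)
  moreover have "(?C1 \<union> {m + 2 * k}) \<inter> ?C3 = {}"
    using ox dy C3 by (fastforce dest: subsetD)
  ultimately have "rainbow_walk E (D \<union> new_verts) colour (?C1 \<union> {m + 2 * k} \<union> ?C3) x u"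
    by (intro rainbow_walk_trans[OF _ u(2)])
  then show ?thesis by (rule that[OF u(1)]) (use C3 dy in auto)
qed

text \<open>Let \<open>x\<close> be the shallower vertex. With equal offsets its descent uses
  palette positions below \<open>depth x\<close>, while the ascent from \<open>y\<close> uses
  positions from \<open>depth y\<close> on, the other palette and the exit colour.\<close>

lemma disjoint_exits:
  assumes "x \<in> D \<union> new_verts" "y \<in> D \<union> new_verts"
  obtains u v C C' where "u \<in> D" "v \<in> D"
    "rainbow_walk E (D \<union> new_verts) colour C x u" "rainbow_walk E (D \<union> new_verts) colour C' y v"
    "C \<inter> C' = {}" "C \<union> C' \<subseteq> {m..<m + 2 * k + 1}"
proof -
  have ordered: "\<exists>u v C C'. u \<in> D \<and> v \<in> D
      \<and> rainbow_walk E (D \<union> new_verts) colour C x u \<and> rainbow_walk E (D \<union> new_verts) colour C' y v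
      \<and> C \<inter> C' = {} \<and> C \<union> C' \<subseteq> {m..<m + 2 * k + 1}"
    if x: "x \<in> D \<union> new_verts" and y: "y \<in> D \<union> new_verts" and le: "depth x \<le> depth y" for x y
  proof -
    have k: "depth x \<le> k" "depth y \<le> k"
      using x y D_sub new_verts_sub depth_le_k by auto
    have off: "offset x = 0 \<or> offset x = k" "offset y = 0 \<or> offset y = k"
      unfolding offset_def by auto
    let ?A = "{m + offset x..<m + offset x + depth x}"
    let ?B = "{m + offset y..<m + offset y + depth y}"
    obtain u where u: "u \<in> D" "rainbow_walk E (D \<union> new_verts) colour ?A x u"
      using descend_to_D[OF x] by blast
    have A: "?A \<subseteq> {m..<m + 2 * k + 1}" using off k by auto
    show ?thesis
    \<comment> \<open>If \<open>y\<close> is in \<open>D\<close>, its descent is trivial and has no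
      colours, so it is disjoint from the other whatever the offsets are.\<close>
    proof (cases "offset x \<noteq> offset y \<or> y \<in> D")
      case True
      obtain v where v: "v \<in> D" "rainbow_walk E (D \<union> new_verts) colour ?B y v"
        using descend_to_D[OF y] by blast
      have "?A \<inter> ?B = {}" using True off k depth_eq_0[of y] D_sub by auto
      moreover have "?B \<subseteq> {m..<m + 2 * k + 1}" using off k by auto
      ultimately show ?thesis using u v A by (meson Un_least)
    next
      case False
      then have "y \<in> new_verts" using y by auto
      then obtain v C where v: "v \<in> D" "rainbow_walk E (D \<union> new_verts) colour C y v"
        "C \<subseteq> {m + offset y + depth y..<m + offset y + k} \<union> {m + 2 * k}
          \<union> {m + (k - offset y)..<m + (k - offset y) + k}"
        by (rule ascend_to_D)
      have "?A \<inter> ({m + offset y + depth y..<m + offset y + k} \<union> {m + 2 * k}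
          \<union> {m + (k - offset y)..<m + (k - offset y) + k}) = {}"
        using False off k le by auto
      then have "?A \<inter> C = {}" using v(3) by blast
      moreover have "{m + offset y + depth y..<m + offset y + k} \<union> {m + 2 * k}
          \<union> {m + (k - offset y)..<m + (k - offset y) + k} \<subseteq> {m..<m + 2 * k + 1}"
        using off by auto
      with v(3) have "C \<subseteq> {m..<m + 2 * k + 1}" by (rule subset_trans)
      ultimately show ?thesis using u v(1,2) A by (meson Un_least)
    qed
  qed
  show ?thesis
  proof (cases "depth x \<le> depth y")
    case True
    from ordered[OF assms True] show ?thesis using that by blast
  next
    case False
    then have "depth y \<le> depth x" by simp
    from ordered[OF assms(2,1) this] obtain u v C C' where "u \<in> D" "v \<in> D"
      "rainbow_walk E (D \<union> new_verts) colour C y u" "rainbow_walk E (D \<union> new_verts) colour C' x v"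
      "C \<inter> C' = {}" "C \<union> C' \<subseteq> {m..<m + 2 * k + 1}" by blast
    then show ?thesis using that[of v u C' C] by (simp add: Int_commute Un_commute)
  qed
qed

text \<open>The walks to \<open>D\<close> use only colours from \<open>m\<close> on, so an old walk
  inside \<open>D\<close> can join their ends. The cost is two palettes of size \<open>k\<close> and
  the exit colour.\<close>

lemma rainbow_set_new_verts:
  assumes "\<And>u v. u \<in> D \<Longrightarrow> v \<in> D \<Longrightarrow> \<exists>C\<subseteq>{..<m}. rainbow_walk E D c C u v"
  shows "rainbow_set E (D \<union> new_verts) (m + 2 * k + 1)"
proof -
  have "\<exists>C\<subseteq>{..<m + 2 * k + 1}. rainbow_walk E (D \<union> new_verts) colour C x y"
    if "x \<in> D \<union> new_verts" "y \<in> D \<union> new_verts" for x y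
  proof -
    obtain u v A B where A: "u \<in> D" "v \<in> D"
      "rainbow_walk E (D \<union> new_verts) colour A x u" "rainbow_walk E (D \<union> new_verts) colour B y v"
      "A \<inter> B = {}" "A \<union> B \<subseteq> {m..<m + 2 * k + 1}"
      using \<open>x \<in> D \<union> new_verts\<close> \<open>y \<in> D \<union> new_verts\<close> by (rule disjoint_exits)
    obtain C where C: "C \<subseteq> {..<m}" "rainbow_walk E D c C u v" using assms A(1,2) by blast
    have "rainbow_walk E (D \<union> new_verts) colour C u v"
      by (rule rainbow_walk_mono[OF C(2)]) (auto simp: colour_def)
    then have "rainbow_walk E (D \<union> new_verts) colour (A \<union> C) x v"
      by (rule rainbow_walk_trans[OF A(3)]) (use A(6) C(1) in fastforce)
    then have "rainbow_walk E (D \<union> new_verts) colour (A \<union> C \<union> B) x y"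
      by (rule rainbow_walk_trans[OF _ rainbow_walk_sym[OF E_sym colour_sym A(4)]])
        (use A(5,6) C(1) in fastforce)
    moreover have "A \<union> C \<union> B \<subseteq> {..<m + 2 * k + 1}" using A(6) C(1) by fastforce
    ultimately show ?thesis by blast
  qed
  then show ?thesis unfolding rainbow_set_def using colour_sym by blast
qed

end

definition cut_connected :: "'a rel \<Rightarrow> 'a set \<Rightarrow> nat \<Rightarrow> bool" where
  "cut_connected E V \<kappa> \<longleftrightarrow>
     (\<forall>S X Y. S \<subseteq> V \<and> X \<union> Y = V - S \<and> X \<inter> Y = {} \<and> X \<noteq> {} \<and> Y \<noteq> {} \<and> card S < \<kappa>
        \<longrightarrow> (\<exists>x\<in>X. \<exists>y\<in>Y. (x, y) \<in> E))"

text \<open>Connectivity is used in this partition form because each application directly yields an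
  edge. The bound on the order of the graph is carried separately.\<close>

lemma cut_connectedD:
  assumes "cut_connected E V \<kappa>" "S \<subseteq> V" "X \<union> Y = V - S" "X \<inter> Y = {}" "X \<noteq> {}" "Y \<noteq> {}"
    "card S < \<kappa>"
  shows "\<exists>x\<in>X. \<exists>y\<in>Y. (x, y) \<in> E"
  using assms unfolding cut_connected_def by meson

text \<open>Deleting the parent of \<open>v\<close> leaves an edge from the tree of \<open>v\<close>
  to the other remaining vertices, if there are any. Deleting \<open>v\<close> instead gives the
  parent a neighbour other than \<open>v\<close>, and that one lies outside the tree.\<close>

lemma (in layering) root_leaving_edge:
  assumes conn: "cut_connected E V \<kappa>" "2 \<le> \<kappa>" and card: "3 \<le> card V"
    and v: "v \<in> V" "depth v = 1"
  obtains (to_D) w where "w \<in> D" "w \<noteq> parent v" "(v, w) \<in> E"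
  | (to_tree) y w where "y \<in> V - D" "w \<in> V - D" "(y, w) \<in> E" "root y = v" "root w \<noteq> v"
proof -
  let ?p = "parent v"
  have vD: "v \<in> V - D" using v depth_eq_0[of v] by auto
  have p: "?p \<in> D" "?p \<in> V" "?p \<noteq> v"
    using parent[OF vD] v(2) depth_eq_0[of ?p] by auto
  define X where "X = {x \<in> V - D. root x = v}"
  define Y where "Y = V - {?p} - X"
  \<comment> \<open>A neighbour of \<open>D\<close> has depth at most 1, so within a tree only the
    root is adjacent to \<open>D\<close>.\<close>
  have unique: "y = v" if "y \<in> X" "(z, y) \<in> E" "z \<in> D" for y z
  proof -
    have y: "y \<in> V - D" "root y = v" using that unfolding X_def by auto
    have "depth z = 0" using that(3) D_sub depth_eq_0[of z] by auto
    then have "depth y = 1" using depth_edge[OF that(2)] depth_pos[OF y(1)] by simp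
    then show ?thesis using root_depth_1[of y] y(2) by simp
  qed
  have "finite V" using card by (metis card.infinite not_numeral_le_zero)
  then have "card (V - {?p, v}) \<noteq> 0" using card p vD by (simp add: card_Diff_subset)
  then have ne: "V - {?p, v} \<noteq> {}" by (metis card.empty)
  have "\<exists>z\<in>{?p}. \<exists>y\<in>V - {?p, v}. (z, y) \<in> E"
    by (rule cut_connectedD[OF conn(1), of "{v}"]) (use p vD ne conn(2) in auto)
  then obtain z y where zy: "z \<in> {?p}" "y \<in> V - {?p, v}" "(z, y) \<in> E" by blast
  then have "y \<notin> X" using unique[of y z] p by auto
  then have "Y \<noteq> {}" using zy unfolding Y_def by auto
  moreover have "v \<in> X" using vD v(2) root_depth_1 unfolding X_def by auto
  moreover have "X \<union> Y = V - {?p}" using p unfolding X_def Y_def by auto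
  ultimately have "\<exists>x\<in>X. \<exists>y\<in>Y. (x, y) \<in> E"
    by (intro cut_connectedD[OF conn(1), of "{?p}"]) (use p conn(2) in \<open>auto simp: Y_def\<close>)
  then obtain x y where xy: "x \<in> X" "y \<in> Y" "(x, y) \<in> E" by blast
  show ?thesis
  proof (cases "y \<in> D")
    case True
    then have "x = v" using unique[OF xy(1)] xy(3) E_sym by (auto dest: symD)
    then show ?thesis using to_D[of y] True xy unfolding Y_def by auto
  next
    case False
    then show ?thesis using to_tree[of x y] xy unfolding X_def Y_def by auto
  qed
qed

text \<open>A maximal independent set does it.\<close>

lemma separating_labelling:
  assumes "finite R" "\<And>v w. H v w \<Longrightarrow> H w v" "\<And>v. \<not> H v v"
  obtains L where
    "\<And>v. v \<in> R \<Longrightarrow> \<exists>w\<in>R. H v w \<Longrightarrow> \<exists>w\<in>R. H v w \<and> (v \<in> L) \<noteq> (w \<in> L)"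
proof -
  define I where "I = {L. L \<subseteq> R \<and> (\<forall>v\<in>L. \<forall>w\<in>L. \<not> H v w)}"
  have "finite I" unfolding I_def using assms(1) by auto
  moreover have "{} \<in> I" unfolding I_def by auto
  ultimately obtain L where L: "L \<in> I" "\<And>L'. L' \<in> I \<Longrightarrow> L \<subseteq> L' \<Longrightarrow> L = L'"
    using finite_has_maximal[of I] by auto
  show ?thesis
  proof (rule that[of L])
    fix v assume v: "v \<in> R" "\<exists>w\<in>R. H v w"
    show "\<exists>w\<in>R. H v w \<and> (v \<in> L) \<noteq> (w \<in> L)"
    proof (cases "v \<in> L")
      case True
      then show ?thesis using v L(1) unfolding I_def by blast
    next
      case False
      then have "insert v L \<notin> I" using L(2)[of "insert v L"] by auto
      then obtain w where "w \<in> L" "H v w \<or> H w v"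
        using L(1) v(1) assms(3) unfolding I_def by blast
      then show ?thesis using False assms(2) L(1) unfolding I_def by blast
    qed
  qed
qed

text \<open>It suffices that every depth-1 vertex is new: then the ball of radius 1 around
  \<open>D\<close> lies in the enlarged set, and the dominating radius drops by one.\<close>

lemma dominating_step:
  assumes "sym E" "E \<subseteq> V \<times> V" "cut_connected E V \<kappa>" "2 \<le> \<kappa>" "3 \<le> card V"
    and "D \<subseteq> V" "V \<subseteq> nball E D (Suc k)" "rainbow_set E D m"
  obtains D' where "D' \<subseteq> V" "V \<subseteq> nball E D' k" "rainbow_set E D' (m + 2 * Suc k + 1)"
proof -
  interpret layering E V D "Suc k" using assms by unfold_locales auto
  define R where "R = {v \<in> V. depth v = 1}"
  \<comment> \<open>\<open>H\<close> is adjacency of trees, represented by their roots.\<close>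
  define H where "H v w \<longleftrightarrow> v \<noteq> w \<and>
    (\<exists>y\<in>V - D. \<exists>z\<in>V - D. (y, z) \<in> E \<and> root y = v \<and> root z = w)" for v w
  have "finite V" using assms(5) by (metis card.infinite not_numeral_le_zero)
  then have "finite R" unfolding R_def by auto
  moreover have "H w v" if "H v w" for v w
    using that E_sym unfolding H_def by (meson symD)
  moreover have "\<not> H v v" for v unfolding H_def by auto
  ultimately obtain L where L:
    "\<And>v. v \<in> R \<Longrightarrow> \<exists>w\<in>R. H v w \<Longrightarrow> \<exists>w\<in>R. H v w \<and> (v \<in> L) \<noteq> (w \<in> L)"
    by (rule separating_labelling[of R H]) auto
  obtain c where c: "\<And>x y. c x y = c y x"
      "\<And>u v. u \<in> D \<Longrightarrow> v \<in> D \<Longrightarrow> \<exists>C\<subseteq>{..<m}. rainbow_walk E D c C u v"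
    using assms(8) unfolding rainbow_set_def by metis
  interpret labelled_layering E V D "Suc k" L m c using c(1) by unfold_locales auto
  have "v \<in> new_verts" if "v \<in> R" for v
  proof -
    have v: "v \<in> V" "depth v = 1" using that unfolding R_def by auto
    then have vD: "v \<in> V - D" using depth_eq_0[of v] by auto
    from assms(3-5) v show ?thesis
    proof (cases rule: root_leaving_edge)
      case (to_D w)
      then have "exit_edge v w" using vD unfolding exit_edge_def by auto
      then show ?thesis by (rule exit_in_new_verts)
    next
      case (to_tree y w)
      then have "H v (root w)" unfolding H_def by blast
      moreover have "root w \<in> R" using root[OF to_tree(2)] unfolding R_def by auto
      \<comment> \<open>The tree reached by the given edge may have the same label as
        \<open>v\<close>; the labelling then supplies some adjacent tree with the other one.\<close>
      ultimately obtain v' where "H v v'" "(v \<in> L) \<noteq> (v' \<in> L)" using L \<open>v \<in> R\<close> by blast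
      then obtain y z where yz: "y \<in> V - D" "z \<in> V - D" "(y, z) \<in> E" "root y = v"
          "(root y \<in> L) \<noteq> (root z \<in> L)"
        unfolding H_def by blast
      then have "exit_edge y z" unfolding exit_edge_def offset_def by auto
      \<comment> \<open>The root \<open>v\<close> is the ancestor of \<open>y\<close> after
        \<open>depth y - 1\<close> steps, hence new.\<close>
      moreover have "depth y - 1 < depth y" using depth_pos[OF yz(1)] by simp
      ultimately show ?thesis
        unfolding new_verts_def using yz(4) unfolding root_def by blast
    qed
  qed
  then have "R \<subseteq> new_verts" by blast
  moreover have "nball E D 1 \<subseteq> D \<union> R"
  proof
    fix x assume x: "x \<in> nball E D 1"
    then have "x \<in> V" using nball_subset[OF E_sub D_sub] by blast
    moreover have "depth x \<le> 1" by (rule depth_leI[OF x])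
    ultimately show "x \<in> D \<union> R" using depth_eq_0[of x] unfolding R_def by fastforce
  qed
  ultimately have "nball E D 1 \<subseteq> D \<union> new_verts" by blast
  then have "nball E (nball E D 1) k \<subseteq> nball E (D \<union> new_verts) k" by (rule nball_mono)
  then have "V \<subseteq> nball E (D \<union> new_verts) k" using D_dom unfolding nball_add by auto
  moreover have "rainbow_set E (D \<union> new_verts) (m + 2 * Suc k + 1)"
    using c(2) by (rule rainbow_set_new_verts)
  ultimately show ?thesis using that[of "D \<union> new_verts"] D_sub new_verts_sub by blast
qed

lemma rainbow_set_dominating:
  assumes "sym E" "E \<subseteq> V \<times> V" "cut_connected E V \<kappa>" "2 \<le> \<kappa>" "3 \<le> card V"
    and "D \<subseteq> V" "V \<subseteq> nball E D k" "rainbow_set E D m"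
  shows "rainbow_set E V (m + k * (k + 2))"
  using assms(6-8)
proof (induction k arbitrary: D m)
  case 0
  then show ?case by auto
next
  case (Suc k)
  obtain D' where D': "D' \<subseteq> V" "V \<subseteq> nball E D' k" "rainbow_set E D' (m + 2 * Suc k + 1)"
    using dominating_step[OF assms(1-5) Suc.prems] by blast
  \<comment> \<open>\<open>k * (k + 2)\<close> is the sum of the costs \<open>2 * j + 1\<close> over
    \<open>j\<close> from 1 to \<open>k\<close>.\<close>
  have "m + 2 * Suc k + 1 + k * (k + 2) = m + Suc k * (Suc k + 2)" by (simp add: algebra_simps)
  then show ?case using Suc.IH[OF D'] by metis
qed

subsection \<open>Packing disjoint balls\<close>

text \<open>The vertex \<open>b\<close> lies beyond every sphere of radius at most \<open>l\<close>,
  so each such sphere separates \<open>v\<close> from \<open>b\<close> and has at least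
  \<open>\<kappa>\<close> vertices.\<close>

lemma card_nball_ge:
  assumes "finite V" "E \<subseteq> V \<times> V" "cut_connected E V \<kappa>" "v \<in> V" "b \<in> V" "b \<notin> nball E {v} l"
    and "i \<le> l"
  shows "\<kappa> * i + 1 \<le> card (nball E {v} i)"
  using assms(7)
proof (induction i)
  case (Suc i)
  let ?B = "nball E {v}"
  have sub: "?B j \<subseteq> V" for j using nball_subset assms(2,4) by blast
  then have fin: "finite (?B j)" for j using assms(1) finite_subset by blast
  have "\<kappa> \<le> card (?B (Suc i) - ?B i)"
  proof (rule ccontr)
    assume *: "\<not> \<kappa> \<le> card (?B (Suc i) - ?B i)"
    have "?B i \<noteq> {}" using center_in_nball[of "{v}" E i] by auto
    moreover have "b \<in> V - ?B (Suc i)"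
      using assms(5,6) nball_radius_mono[OF Suc.prems, of E "{v}"] by blast
    moreover have "?B i \<subseteq> ?B (Suc i)" by (rule nball_radius_mono) simp
    ultimately have "\<exists>x\<in>?B i. \<exists>y\<in>V - ?B (Suc i). (x, y) \<in> E"
      by (intro cut_connectedD[OF assms(3), of "?B (Suc i) - ?B i"])
        (use * sub[of i] sub[of "Suc i"] in \<open>auto simp del: nball.simps\<close>)
    then show False by auto
  qed
  moreover have "card (?B (Suc i)) = card (?B i) + card (?B (Suc i) - ?B i)"
    using fin[of "Suc i"] nball_radius_mono[of i "Suc i" E "{v}"]
    by (metis card_mono card_Diff_subset fin le_SucI le_add_diff_inverse order_refl)
  ultimately show ?case using Suc by simp
qed simp

text \<open>The greedy process is replaced by a pair \<open>D\<close>, \<open>C\<close> with as many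
  centres as possible. If \<open>D\<close> did not dominate, an edge leaving its ball of radius
  \<open>2 * l\<close> would supply a further centre, at a cost of \<open>2 * l + 1\<close>
  colours.\<close>

lemma dominating_packing:
  assumes "finite V" "V \<noteq> {}" "sym E" "E \<subseteq> V \<times> V" "cut_connected E V 1"
  obtains D C where "C \<subseteq> V" "C \<noteq> {}" "D \<subseteq> V" "V \<subseteq> nball E D (2 * l)"
    "rainbow_set E D ((2 * l + 1) * (card C - 1))"
    "\<forall>a\<in>C. \<forall>b\<in>C. a \<noteq> b \<longrightarrow> nball E {a} l \<inter> nball E {b} l = {}"
proof -
  define P where "P D C \<longleftrightarrow> C \<subseteq> D \<and> C \<noteq> {} \<and> D \<subseteq> V \<and> rainbow_set E D ((2 * l + 1) * (card C - 1))
    \<and> (\<forall>a\<in>C. \<forall>b\<in>C. a \<noteq> b \<longrightarrow> nball E {a} l \<inter> nball E {b} l = {})" for D C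
  let ?Q = "\<lambda>t. \<exists>D C. P D C \<and> card C = t"
  obtain v where v: "v \<in> V" using assms(2) by blast
  then have "P {v} {v}" unfolding P_def using rainbow_set_singleton by auto
  then have ex: "?Q 1" by (intro exI[of _ "{v}"]) auto
  have bounded: "t \<le> card V" if "?Q t" for t
    using that assms(1) unfolding P_def by (meson card_mono subset_trans)
  obtain D C where DC: "P D C" "card C = (GREATEST t. ?Q t)"
    using GreatestI_nat[of ?Q, OF ex] bounded by blast
  have max: "card C' \<le> card C" if "P D' C'" for D' C'
    unfolding DC(2) by (rule Greatest_le_nat[where b = "card V"]) (use that bounded in blast)+
  have sub: "nball E D i \<subseteq> V" for i using nball_subset[OF assms(4)] DC(1) unfolding P_def by blast
  have finC: "finite C" using DC(1) assms(1) unfolding P_def by (meson finite_subset)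
  have "V \<subseteq> nball E D (2 * l)"
  proof (rule ccontr)
    assume not_dom: "\<not> V \<subseteq> nball E D (2 * l)"
    have "nball E D (2 * l) \<noteq> {}"
      using center_in_nball[of D E "2 * l"] DC(1) unfolding P_def by auto
    then have "\<exists>y\<in>nball E D (2 * l). \<exists>z\<in>V - nball E D (2 * l). (y, z) \<in> E"
      by (intro cut_connectedD[OF assms(5), of "{}"]) (use sub[of "2 * l"] not_dom in auto)
    then obtain y z where z: "y \<in> nball E D (2 * l)" "z \<in> V - nball E D (2 * l)" "(y, z) \<in> E"
      by blast
    then have "z \<in> nball E D (2 * l + 1)" by auto
    then obtain D' where D': "D \<subseteq> D'" "D' \<subseteq> V" "z \<in> D'"
        "rainbow_set E D' ((2 * l + 1) * (card C - 1) + (2 * l + 1))"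
      using rainbow_set_extend_to[OF assms(3,4)] DC(1) unfolding P_def by metis
    have zC: "z \<notin> C" using z(2) center_in_nball[of D E "2 * l"] DC(1) unfolding P_def by auto
    have "card C \<noteq> 0" using DC(1) finC unfolding P_def by auto
    then have "(2 * l + 1) * (card C - 1) + (2 * l + 1) = (2 * l + 1) * (card (insert z C) - 1)"
      using zC finC by (cases "card C") auto
    moreover have far: "nball E {a} l \<inter> nball E {z} l = {}" if "a \<in> C" for a
    proof (rule ccontr)
      assume "nball E {a} l \<inter> nball E {z} l \<noteq> {}"
      then obtain w where w: "w \<in> nball E {a} l" "z \<in> nball E {w} l"
        using nball_singleton_sym[OF assms(3)] by blast
      \<comment> \<open>Centres lie in \<open>D\<close>, so a vertex common to both balls would put
        \<open>z\<close> within \<open>2 * l\<close> of \<open>D\<close>.\<close>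
      have "nball E {w} l \<subseteq> nball E (nball E {a} l) l" using w(1) by (intro nball_mono) auto
      moreover have "nball E {a} (l + l) \<subseteq> nball E D (l + l)"
        using \<open>a \<in> C\<close> DC(1) unfolding P_def by (intro nball_mono) auto
      ultimately show False using w(2) z(2) unfolding nball_add mult_2 by blast
    qed
    ultimately have "P D' (insert z C)"
      using D' DC(1) far unfolding P_def by (auto simp: Int_commute)
    then show False using max[of D' "insert z C"] zC finC by simp
  qed
  then show ?thesis using that[of C D] DC(1) unfolding P_def by blast
qed

text \<open>The reduction of the radius needs \<open>2 \<le> \<kappa>\<close>. For
  \<open>\<kappa> = 1\<close> a spanning tree, which is the packing with radius 0, already meets the
  bound since the factor of the order is at least 1.\<close>

lemma cut_connected_rainbow_set:
  assumes "finite V" "sym E" "E \<subseteq> V \<times> V" "cut_connected E V \<kappa>" "1 \<le> \<kappa>" "\<kappa> < card V"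
  shows "\<exists>m. rainbow_set E V m \<and>
    real m \<le> (2 * real l + 1) / (real \<kappa> * real l + 1) * real (card V)
      + 2 * real l * (2 * real l + 2) - 1"
proof -
  have ne: "V \<noteq> {}" using assms(6) by auto
  have conn: "cut_connected E V 1"
    using assms(4,5) unfolding cut_connected_def by (meson less_le_trans)
  show ?thesis
  proof (cases "\<kappa> = 1")
    case True
    obtain D C where DC: "C \<subseteq> V" "C \<noteq> {}" "D \<subseteq> V" "V \<subseteq> nball E D (2 * 0)"
      "rainbow_set E D ((2 * 0 + 1) * (card C - 1))"
      using dominating_packing[OF assms(1) ne assms(2,3) conn, of 0] by metis
    have "rainbow_set E V (card V - 1)"
      using DC card_mono[OF assms(1) DC(1)]
      by (auto intro: rainbow_set_mono simp: subset_antisym)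
    moreover have growth: "1 * real (card V) \<le> (2 * real l + 1) / (real \<kappa> * real l + 1) * real (card V)"
      using True by (intro mult_right_mono) (auto simp: field_simps)
    moreover have "real (card V - 1) \<le> (2 * real l + 1) / (real \<kappa> * real l + 1) * real (card V)
      + 2 * real l * (2 * real l + 2) - 1"
    proof -
      have "0 \<le> 2 * real l * (2 * real l + 2)" by simp
      moreover have "real (card V - 1) = real (card V) - 1" using assms(6) by (simp add: of_nat_diff)
      ultimately show ?thesis using growth by linarith
    qed
    ultimately show ?thesis by blast
  next
    case False
    then have \<kappa>: "2 \<le> \<kappa>" "3 \<le> card V" using assms(5,6) by auto
    obtain D C where DC: "C \<subseteq> V" "C \<noteq> {}" "D \<subseteq> V" "V \<subseteq> nball E D (2 * l)"
      "rainbow_set E D ((2 * l + 1) * (card C - 1))"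
      "\<forall>a\<in>C. \<forall>b\<in>C. a \<noteq> b \<longrightarrow> nball E {a} l \<inter> nball E {b} l = {}"
      by (rule dominating_packing[OF assms(1) ne assms(2,3) conn, where l = l]) (rule that)
    let ?m = "(2 * l + 1) * (card C - 1) + 2 * l * (2 * l + 2)"
    have "rainbow_set E V ?m"
      by (rule rainbow_set_dominating[OF assms(2-4) \<kappa> DC(3-5)])
    have finC: "finite C" using DC(1) assms(1) by (rule finite_subset)
    then have C_pos: "1 \<le> card C" using DC(2) by (simp add: Suc_le_eq card_gt_0_iff)
    have pos: "0 < real \<kappa> * real l + 1" by (simp add: add_nonneg_pos)
    \<comment> \<open>The first centre costs no colours, which leaves room for the final
      \<open>- 1\<close> of the bound.\<close>
    have "real (2 * l + 1) * real (card C - 1) + 1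
        \<le> (2 * real l + 1) / (real \<kappa> * real l + 1) * real (card V)"
    proof (cases "card C = 1")
      case True
      \<comment> \<open>The ball of a single centre may be the whole graph, so
        \<open>\<kappa> < card V\<close> takes the place of the sphere count.\<close>
      have "\<kappa> * l + 1 \<le> (2 * l + 1) * card V"
      proof -
        have "\<kappa> * l \<le> card V * (2 * l)" by (rule mult_le_mono) (use assms(6) in auto)
        moreover have "(2 * l + 1) * card V = card V * (2 * l) + card V" by simp
        ultimately show ?thesis using assms(6) by linarith
      qed
      then have "real (\<kappa> * l + 1) \<le> real ((2 * l + 1) * card V)" by (rule of_nat_mono)
      then show ?thesis using True pos by (simp add: field_simps)
    next
      case False
      have ball: "\<kappa> * l + 1 \<le> card (nball E {a} l)" if "a \<in> C" for a
      proof -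
        have "C \<noteq> {a}" using False by auto
        with that obtain b where b: "b \<in> C" "b \<noteq> a" by blast
        \<comment> \<open>A second centre serves as the far vertex, since its own ball avoids that
          of \<open>a\<close>.\<close>
        have "b \<notin> nball E {a} l"
          using DC(6) that b center_in_nball[of "{b}" E l] by blast
        then show ?thesis
          using card_nball_ge[OF assms(1,3,4), of a b l l] that b(1) DC(1) by blast
      qed
      have sub: "nball E {a} l \<subseteq> V" if "a \<in> C" for a
        using nball_subset[OF assms(3)] that DC(1) by blast
      have "card C * (\<kappa> * l + 1) \<le> (\<Sum>a\<in>C. card (nball E {a} l))"
        using sum_mono[of C "\<lambda>_. \<kappa> * l + 1", OF ball] by simp
      also have "\<dots> = card (\<Union>a\<in>C. nball E {a} l)"
        using finC sub DC(6) assms(1) by (intro card_UN_disjoint[symmetric]) (auto intro: finite_subset)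
      also have "\<dots> \<le> card V" using sub by (intro card_mono assms(1)) blast
      finally have "real (card C * (\<kappa> * l + 1)) \<le> real (card V)" by (rule of_nat_mono)
      then have "real (card C) \<le> real (card V) / (real \<kappa> * real l + 1)"
        using pos by (simp add: field_simps)
      then have "(2 * real l + 1) * real (card C)
          \<le> (2 * real l + 1) * (real (card V) / (real \<kappa> * real l + 1))"
        by (rule mult_left_mono) simp
      then show ?thesis using C_pos by (simp add: of_nat_diff algebra_simps)
    qed
    moreover have "real ?m = real (2 * l + 1) * real (card C - 1) + 2 * real l * (2 * real l + 2)"
      by (simp only: of_nat_add of_nat_mult of_nat_numeral)
    ultimately have "real ?m \<le> (2 * real l + 1) / (real \<kappa> * real l + 1) * real (card V)
      + 2 * real l * (2 * real l + 2) - 1"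
      by linarith
    with \<open>rainbow_set E V ?m\<close> show ?thesis by blast
  qed
qed

subsection \<open>Transfer to the graph library\<close>

text \<open>Without a crossing edge, everything reachable from a vertex of \<open>X\<close> stays in
  \<open>X\<close>.\<close>

lemma connected_induced_edge:
  assumes "Digraph_Component.connected (with_proj G \<restriction> W)" "sym (parcs G)"
    and "X \<union> Y = W" "X \<inter> Y = {}" "X \<noteq> {}" "Y \<noteq> {}"
  shows "\<exists>x\<in>X. \<exists>y\<in>Y. (x, y) \<in> parcs G"
proof (rule ccontr)
  assume none: "\<not> (\<exists>x\<in>X. \<exists>y\<in>Y. (x, y) \<in> parcs G)"
  obtain a b where ab: "a \<in> X" "b \<in> Y" using assms by auto
  have "(a, b) \<in> rtrancl_on W ((arcs_ends (with_proj G \<restriction> W))\<^sup>s)"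
    using assms(1,3) ab unfolding connected_conv by auto
  then have "b \<in> X"
  proof (induction rule: rtrancl_on_induct)
    case base
    show ?case by (rule ab)
  next
    case (step y z)
    then have "(y, z) \<in> parcs G"
      using assms(2) by (auto simp: symcl_def arcs_ends_conv sym_def)
    then show ?case using none step assms(3) by auto
  qed
  then show False using ab assms(4) by auto
qed

lemma vertex_connectivity_cut_connected:
  assumes "sym (parcs G)" "\<kappa> \<le> vertex_connectivity G"
  shows "cut_connected (parcs G) (pverts G) \<kappa>"
  unfolding cut_connected_def
proof (intro allI impI, elim conjE)
  fix S X Y
  assume S: "S \<subseteq> pverts G" "card S < \<kappa>"
    and XY: "X \<union> Y = pverts G - S" "X \<inter> Y = {}" "X \<noteq> {}" "Y \<noteq> {}"
  have "\<not> disconnects G S"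
  proof
    assume *: "disconnects G S"
    then have "vertex_connectivity G = (LEAST k. \<exists>S. disconnects G S \<and> card S = k)"
      unfolding vertex_connectivity_def by auto
    also have "\<dots> \<le> card S" using * by (intro Least_le) blast
    finally show False using assms(2) S(2) by simp
  qed
  \<comment> \<open>As \<open>X\<close> is nonempty, \<open>S\<close> is not the whole vertex set,
    so only connectedness can have kept it from disconnecting.\<close>
  then have "Digraph_Component.connected (with_proj G \<restriction> (pverts G - S))"
    using S XY unfolding disconnects_def by auto
  then show "\<exists>x\<in>X. \<exists>y\<in>Y. (x, y) \<in> parcs G"
    using connected_induced_edge[OF _ assms(1) XY] by blast
qed

lemma vertex_connectivity_less_card:
  assumes "finite (pverts G)" "0 < vertex_connectivity G"
  shows "vertex_connectivity G < card (pverts G)"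
proof (cases "\<exists>S. disconnects G S")
  case True
  then obtain S where S: "disconnects G S" by blast
  have "vertex_connectivity G = (LEAST k. \<exists>S. disconnects G S \<and> card S = k)"
    using True unfolding vertex_connectivity_def by auto
  also have "\<dots> \<le> card S" using S by (intro Least_le) blast
  also have "\<dots> < card (pverts G)"
    using S assms(1) unfolding disconnects_def by (intro psubset_card_mono) auto
  finally show ?thesis .
next
  case False
  then have "vertex_connectivity G = card (pverts G) - 1"
    unfolding vertex_connectivity_def by (rule if_not_P)
  then show ?thesis using assms(2) by linarith
qed

text \<open>If the new first vertex already occurs on the path, the path is cut back to its suffix
  from there, which uses no further arcs or colours.\<close>

lemma vpath_of_rainbow_walk:
  assumes "rainbow_walk (parcs G) (pverts G) c C u v"
  obtains p where "vpath p (with_proj G)" "hd p = u" "last p = v"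
    "distinct (map (\<lambda>(x, y). c x y) (vwalk_arcs p))"
    "(\<lambda>(x, y). c x y) ` set (vwalk_arcs p) \<subseteq> C"
  using assms
proof (induction arbitrary: thesis rule: rainbow_walk.induct)
  case (refl u)
  show ?case by (rule refl.prems[of "[u]"]) (use refl.hyps in auto)
next
  case (step u w C v)
  obtain p where p: "vpath p (with_proj G)" "hd p = w" "last p = v"
    "distinct (map (\<lambda>(x, y). c x y) (vwalk_arcs p))"
    "(\<lambda>(x, y). c x y) ` set (vwalk_arcs p) \<subseteq> C"
    using step.IH by blast
  then have ne: "p \<noteq> []" by auto
  show ?case
  proof (cases "u \<in> set p")
    case False
    have "vpath (u # p) (with_proj G)"
      using p(1,2) False step.hyps(1,2) by (auto intro!: vpathI vwalk_consI)
    moreover have "c u w \<notin> (\<lambda>(x, y). c x y) ` set (vwalk_arcs p)" using p(5) step.hyps(4) by auto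
    ultimately show ?thesis
      using step.prems[of "u # p"] p(2-5) ne by auto
  next
    case True
    then obtain a b where ab: "p = a @ u # b" by (meson split_list)
    have "distinct (map (\<lambda>(x, y). c x y) (vwalk_arcs (u # b)))"
      using p(4) unfolding ab by (cases "a = []") (auto simp: vwalk_arcs_append)
    moreover have "set (vwalk_arcs (u # b)) \<subseteq> set (vwalk_arcs p)"
      unfolding ab by (rule set_vwalk_arcs_append2)
    moreover from this have "vpath (u # b) (with_proj G)"
      using p(1) ab by (auto simp: vpath_def vwalk_def)
    ultimately show ?thesis
      using step.prems[of "u # b"] p(3,5) ab by auto
  qed
qed

lemma rainbow_connection_number_le:
  assumes "pair_graph G" "rainbow_set (parcs G) (pverts G) m"
  shows "rainbow_connection_number G \<le> m"
proof -
  obtain c where c: "\<And>x y. c x y = c y x"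
    "\<And>u v. u \<in> pverts G \<Longrightarrow> v \<in> pverts G
      \<Longrightarrow> \<exists>C\<subseteq>{..<m}. rainbow_walk (parcs G) (pverts G) c C u v"
    using assms(2) unfolding rainbow_set_def by metis
  \<comment> \<open>Colours of ordered pairs become colours of two-element sets by choosing an
    order; symmetry of \<open>c\<close> makes the choice immaterial.\<close>
  define pick where "pick e = (SOME q. e = {fst q, snd q})" for e :: "'a set"
  \<comment> \<open>Colours from \<open>m\<close> on may occur off the chosen walks; they are reset
    to 0, which is a permitted colour when \<open>m\<close> is positive.\<close>
  define d where "d e = (let i = c (fst (pick e)) (snd (pick e)) in if i < m then i else 0)" for e
  have d: "d {x, y} = (if c x y < m then c x y else 0)" for x y
  proof -
    have "{x, y} = {fst (pick {x, y}), snd (pick {x, y})}"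
      unfolding pick_def by (rule someI[of _ "(x, y)"]) simp
    then show ?thesis using c(1) unfolding d_def by (auto simp: doubleton_eq_iff Let_def)
  qed
  have "rainbow_colouring G d"
    unfolding rainbow_colouring_def
  proof (intro ballI)
    fix u v assume "u \<in> pverts G" "v \<in> pverts G"
    then obtain C where C: "C \<subseteq> {..<m}" "rainbow_walk (parcs G) (pverts G) c C u v"
      using c(2) by blast
    obtain p where p: "vpath p (with_proj G)" "hd p = u" "last p = v"
      "distinct (map (\<lambda>(x, y). c x y) (vwalk_arcs p))"
      "(\<lambda>(x, y). c x y) ` set (vwalk_arcs p) \<subseteq> C"
      using vpath_of_rainbow_walk[OF C(2)] by blast
    have "map (\<lambda>(x, y). d {x, y}) (vwalk_arcs p) = map (\<lambda>(x, y). c x y) (vwalk_arcs p)"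
      using p(5) C(1) by (intro map_cong) (force simp: d)+
    then show "\<exists>p. rainbow_path G d u p v"
      unfolding rainbow_path_def using p(1-4) by metis
  qed
  then have "rainbow_connection_number G \<le> card (d ` edges G)"
    unfolding rainbow_connection_number_def by (intro Least_le) blast
  also have "\<dots> \<le> m"
  proof (cases "m = 0")
    case False
    have "d ` edges G \<subseteq> {..<m}" using False unfolding edges_def by (auto simp: d)
    then have "card (d ` edges G) \<le> card {..<m}" by (intro card_mono) auto
    then show ?thesis by simp
  next
    case True
    interpret pair_graph G by (rule assms(1))
    \<comment> \<open>Without colours every walk is trivial, so there is at most one vertex and
      hence no edge for the default colour.\<close>
    have "u = v" if "u \<in> pverts G" "v \<in> pverts G" for u v
    proof -
      have "rainbow_walk (parcs G) (pverts G) c {} u v" using c(2)[OF that] True by auto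
      then show ?thesis by (cases rule: rainbow_walk.cases) auto
    qed
    then have "parcs G = {}" using no_loops' in_arcsD1 in_arcsD2 by fast
    then show ?thesis unfolding edges_def by simp
  qed
  finally show ?thesis .
qed

theorem theorem1:
  fixes G :: "'a pair_pre_digraph" and \<kappa> n l :: nat
  assumes "pair_graph G"
    and "\<kappa> \<ge> 1"
    and "vertex_connectivity G \<ge> \<kappa>"
    and "card (pverts G) = n"
  shows "real (rainbow_connection_number G)
      \<le> ((2 * real l + 1) / (real \<kappa> * real l + 1)) * real n
          + 2 * real l * (2 * real l + 2) - 1"
proof -
  interpret pair_graph G by (rule assms(1))
  have sym: "sym (parcs G)" using pair_sym_arcs by (simp add: symmetric_def)
  have sub: "parcs G \<subseteq> pverts G \<times> pverts G" using in_arcsD1 in_arcsD2 by auto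
  have "\<kappa> < card (pverts G)"
    using vertex_connectivity_less_card[OF pair_finite_verts] assms(2,3) by linarith
  from cut_connected_rainbow_set[OF pair_finite_verts sym sub
      vertex_connectivity_cut_connected[OF sym assms(3)] assms(2) this, of l]
  obtain m where m: "rainbow_set (parcs G) (pverts G) m"
    "real m \<le> (2 * real l + 1) / (real \<kappa> * real l + 1) * real (card (pverts G))
      + 2 * real l * (2 * real l + 2) - 1" by blast
  have "real (rainbow_connection_number G) \<le> real m"
    using rainbow_connection_number_le[OF assms(1) m(1)] by simp
  with m(2) show ?thesis unfolding assms(4) by linarith
qed

end
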